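(* Let $n\ge 5$, $2\le i\le\lfloor n/2\rfloor$, $2\le j\le\lceil n/2\rceil$, $j\neq i$. The subgroup $\mathbf{Z}_{E_{i,j}}$ of the $n\times n\times n$ Rubik's Cube group $\mathbf{G}$ consisting of the elements that fix every facelet outside the center edge orbit $(i,j)$ is isomorphic to the alternating group $\mathcal{A}_{24}$ (both for odd and for even $n$).
   Context: The $n\times n\times n$ Rubik's Cube has faces U, D, F, B, R, L, each an $n\times n$ grid of facelets carrying stickers ($6n^2$ in total). For $1\le k\le\lfloor n/2\rfloor$, $F_k,B_k,R_k,L_k,U_k,D_k$ denote clockwise (seen from the named face) $90^\circ$ rotations of the $k$-th $n\times n\times 1$ slice counted from the named face. $\mathbf{G}$ is the subgroup of the symmetric group on the facelets generated by the facelet permutations induced by these moves. On each face index facelets by $(r,c)$, $1\le r,c\le n$ (as seen from outside). The center edge orbit $(i,j)$ is the set of 24 facelets which on each of the six faces occupy the four positions $(i,j),(j,n+1-i),(n+1-i,n+1-j),(n+1-j,i)$ (these belong to one-sticker center cubies). *)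

theory Defs
  imports "HOL-Algebra.Bij" "HOL-Algebra.Generated_Groups" "HOL-Algebra.Sym_Groups"
begin

datatype face = Up | Down | Front | Back | Right | Left

text \<open>A facelet is (face, row, column). Rows and columns are counted from the top left corner
  of the face as seen from outside, the six faces being laid out in the usual net
  \<^verbatim>\<open>
          Up
    Left Front Right Back
         Down
  \<close>
  so that, for instance, row n of Up, row 1 of Down, column n of Left and column 1 of Right
  are the lines adjacent to Front, while row 1 of Up and row n of Down are adjacent to Back.\<close>

type_synonym facelet = "face \<times> nat \<times> nat"

definition facelets :: "nat \<Rightarrow> facelet set" where
  "facelets n = UNIV \<times> {1..n} \<times> {1..n}"

text \<open>The effect of a clockwise quarter turn of the k-th slice, counted from the face in the
  second argument, on the four lines of facelets that run around the slice. A facelet is mapped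
  to the place its sticker is carried to.\<close>

fun turn_ring :: "nat \<Rightarrow> face \<Rightarrow> nat \<Rightarrow> facelet \<Rightarrow> facelet" where
  "turn_ring n Up k (Front, r, c) = (if r = k then (Left, r, c) else (Front, r, c))"
| "turn_ring n Up k (Left, r, c) = (if r = k then (Back, r, c) else (Left, r, c))"
| "turn_ring n Up k (Back, r, c) = (if r = k then (Right, r, c) else (Back, r, c))"
| "turn_ring n Up k (Right, r, c) = (if r = k then (Front, r, c) else (Right, r, c))"

| "turn_ring n Down k (Front, r, c) = (if r = n + 1 - k then (Right, r, c) else (Front, r, c))"
| "turn_ring n Down k (Right, r, c) = (if r = n + 1 - k then (Back, r, c) else (Right, r, c))"
| "turn_ring n Down k (Back, r, c) = (if r = n + 1 - k then (Left, r, c) else (Back, r, c))"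
| "turn_ring n Down k (Left, r, c) = (if r = n + 1 - k then (Front, r, c) else (Left, r, c))"

| "turn_ring n Front k (Up, r, c) = (if r = n + 1 - k then (Right, c, k) else (Up, r, c))"
| "turn_ring n Front k (Right, r, c) = (if c = k then (Down, k, n + 1 - r) else (Right, r, c))"
| "turn_ring n Front k (Down, r, c) = (if r = k then (Left, c, n + 1 - k) else (Down, r, c))"
| "turn_ring n Front k (Left, r, c) =
     (if c = n + 1 - k then (Up, n + 1 - k, n + 1 - r) else (Left, r, c))"

| "turn_ring n Back k (Up, r, c) = (if r = k then (Left, n + 1 - c, k) else (Up, r, c))"
| "turn_ring n Back k (Left, r, c) = (if c = k then (Down, n + 1 - k, r) else (Left, r, c))"
| "turn_ring n Back k (Down, r, c) =
     (if r = n + 1 - k then (Right, n + 1 - c, n + 1 - k) else (Down, r, c))"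
| "turn_ring n Back k (Right, r, c) = (if c = n + 1 - k then (Up, k, r) else (Right, r, c))"

| "turn_ring n Right k (Front, r, c) = (if c = n + 1 - k then (Up, r, c) else (Front, r, c))"
| "turn_ring n Right k (Up, r, c) = (if c = n + 1 - k then (Back, n + 1 - r, k) else (Up, r, c))"
| "turn_ring n Right k (Back, r, c) =
     (if c = k then (Down, n + 1 - r, n + 1 - k) else (Back, r, c))"
| "turn_ring n Right k (Down, r, c) = (if c = n + 1 - k then (Front, r, c) else (Down, r, c))"

| "turn_ring n Left k (Front, r, c) = (if c = k then (Down, r, c) else (Front, r, c))"
| "turn_ring n Left k (Down, r, c) = (if c = k then (Back, n + 1 - r, n + 1 - k) else (Down, r, c))"
| "turn_ring n Left k (Back, r, c) = (if c = n + 1 - k then (Up, n + 1 - r, k) else (Back, r, c))"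
| "turn_ring n Left k (Up, r, c) = (if c = k then (Front, r, c) else (Up, r, c))"

| "turn_ring n X k x = x"

text \<open>The outermost slice also carries the facelets of the face itself. (The opposite face is
  never moved, since k is at most n div 2 for the turns used below.)\<close>

definition slice_turn :: "nat \<Rightarrow> face \<Rightarrow> nat \<Rightarrow> facelet \<Rightarrow> facelet" where
  "slice_turn n X k = (\<lambda>(f, r, c).
     if f = X \<and> k = 1 then (f, c, n + 1 - r) else turn_ring n X k (f, r, c))"

definition slice_turns :: "nat \<Rightarrow> (facelet \<Rightarrow> facelet) set" where
  "slice_turns n = {restrict (slice_turn n X k) (facelets n) | X k. 1 \<le> k \<and> k \<le> n div 2}"

definition rubik_group :: "nat \<Rightarrow> (facelet \<Rightarrow> facelet) monoid" where
  "rubik_group n = subgroup_generated (BijGroup (facelets n)) (slice_turns n)"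

definition center_edge_orbit :: "nat \<Rightarrow> nat \<Rightarrow> nat \<Rightarrow> facelet set" where
  "center_edge_orbit n i j =
     UNIV \<times> {(i, j), (j, n + 1 - i), (n + 1 - i, n + 1 - j), (n + 1 - j, i)}"

definition Z_center_edge :: "nat \<Rightarrow> nat \<Rightarrow> nat \<Rightarrow> (facelet \<Rightarrow> facelet) set" where
  "Z_center_edge n i j =
     {g \<in> carrier (rubik_group n). \<forall>x \<in> facelets n - center_edge_orbit n i j. g x = x}"

text \<open>\<^const>\<open>subgroup_generated\<close> discards generators outside the carrier; the following facts
  show that none are lost here.\<close>

lemma slice_turn_in_facelets:
  assumes "1 \<le> k" "k \<le> n div 2" "x \<in> facelets n"
  shows "slice_turn n X k x \<in> facelets n"
proof -
  obtain f r c where x: "x = (f, r, c)" by (cases x)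
  show ?thesis using assms unfolding x
    by (cases X; cases f) (auto simp: slice_turn_def facelets_def)
qed

lemma slice_turn_4:
  assumes "1 \<le> k" "k \<le> n div 2" "x \<in> facelets n"
  shows "slice_turn n X k (slice_turn n X k (slice_turn n X k (slice_turn n X k x))) = x"
proof -
  obtain f r c where x: "x = (f, r, c)" by (cases x)
  show ?thesis using assms unfolding x
    by (cases X; cases f) (auto simp: slice_turn_def facelets_def)
qed

lemma slice_turns_subset_Bij: "slice_turns n \<subseteq> carrier (BijGroup (facelets n))"
proof
  fix g assume "g \<in> slice_turns n"
  then obtain X k where k: "1 \<le> k" "k \<le> n div 2"
    and g: "g = restrict (slice_turn n X k) (facelets n)"
    by (auto simp: slice_turns_def)
  let ?t = "slice_turn n X k"
  have "bij_betw ?t (facelets n) (facelets n)"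
    by (rule bij_betw_byWitness[where f' = "\<lambda>x. ?t (?t (?t x))"])
      (simp_all add: image_subset_iff slice_turn_4[OF k] slice_turn_in_facelets[OF k])
  then show "g \<in> carrier (BijGroup (facelets n))"
    by (simp add: g BijGroup_def Bij_def bij_betw_restrict_eq)
qed

lemma carrier_rubik_group:
  "carrier (rubik_group n) = generate (BijGroup (facelets n)) (slice_turns n)"
  using slice_turns_subset_Bij[of n]
  by (simp add: rubik_group_def carrier_subgroup_generated Int_absorb1)

end

theory Submission
  imports Defs
begin

text \<open>
  Upper bound: besides the orbit \<open>(i, j)\<close>, take the corner facelets, the facelets at the rotations
  of \<open>(1, i)\<close> and, unless column \<open>j\<close> is the middle one, those at the rotations of \<open>(1, j)\<close>. Every
  quarter turn consists of an even number of 4-cycles on this union, so every element of the group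
  is even on it; an element fixing everything outside the orbit is therefore even on the orbit.

  Lower bound: the supports of the slice turn \<open>R\<^sub>i\<close> and of \<open>U L\<^sub>j U\<^sup>-\<^sup>1\<close> meet in a single facelet, so
  their commutator is a 3-cycle in the orbit. If \<open>j\<close> is the middle index, then \<open>L\<^sub>j\<close> is not a
  generator, but up to a rotation of the whole cube it is a product of slice turns; hence it
  normalises what is needed and the commutator still lies in the group. Conjugating by slice turns
  shows that any two facelets of the orbit lie in a common such 3-cycle, which yields all 3-cycles.
\<close>

subsection \<open>Permutations\<close>

text \<open>The conjugate of \<open>inv' a\<close> by \<open>b\<close> is \<open>inv' a\<close> with
  \<open>p\<close> relabelled as \<open>b p\<close>, because \<open>b\<close> fixes every other
  point that \<open>a\<close> moves. Composed with \<open>a\<close>, everything cancels except on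
  three points.\<close>

lemma commutator_three_cycle:
  assumes "bij a" "bij b" "a p \<noteq> p" "b p \<noteq> p"
    and one: "\<And>x. a x \<noteq> x \<Longrightarrow> b x \<noteq> x \<Longrightarrow> x = p"
  shows "a \<circ> b \<circ> inv' a \<circ> inv' b = cycle_of_list [p, a p, b p]"
proof
  fix x
  note a = bij_is_inj[OF assms(1)] bij_is_surj[OF assms(1)]
  note b = bij_is_inj[OF assms(2)] bij_is_surj[OF assms(2)]
  have ia: "inv' a y = z \<longleftrightarrow> y = a z" for y z
    using a by (metis inv_f_f surj_f_inv_f)
  have ib: "inv' b y = z \<longleftrightarrow> y = b z" for y z
    using b by (metis inv_f_f surj_f_inv_f)
  have ap: "a (a p) \<noteq> a p" and bp: "b (b p) \<noteq> b p"
    using assms(3,4) inj_eq[OF a(1)] inj_eq[OF b(1)] by auto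
  \<comment> \<open>\<open>a\<close> moves \<open>a p\<close> and \<open>b\<close> moves
    \<open>b p\<close>. Both points differ from \<open>p\<close>, so by \<open>one\<close> the other
    map must fix them.\<close>
  have bap: "b (a p) = a p" and abp: "a (b p) = b p"
    using one[OF ap] one[OF _ bp] assms(3,4) by auto
  have ne: "a p \<noteq> b p" using bap bp by auto
  have key: "a (b (inv' a (inv' b x))) = cycle_of_list [p, a p, b p] x"
  proof -
    consider "x = p" | "x = a p" | "x = b p" | "x \<noteq> p" "x \<noteq> a p" "x \<noteq> b p" by blast
    then show ?thesis
    proof cases
      case 1
      define y where "y = inv' b p"
      have y: "b y = p" "y \<noteq> p" using ib[of p y] assms(4) y_def by auto
      have "a y = y" using one[of y] y by auto
      then have "inv' a y = y" using ia by simp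
      then show ?thesis using 1 y y_def assms(3,4) ne by simp
    next
      case 2
      have "inv' b (a p) = a p" "inv' a (a p) = p" using ib ia bap by auto
      then show ?thesis using 2 abp assms(3,4) ne by simp
    next
      case 3
      define y where "y = inv' a p"
      have y: "a y = p" "y \<noteq> p" using ia[of p y] assms(3) y_def by auto
      have "b y = y" using one[of y] y by auto
      moreover have "inv' b (b p) = p" using ib by simp
      ultimately show ?thesis using 3 y y_def assms(3,4) ne by simp
    next
      case 4
      have c: "cycle_of_list [p, a p, b p] x = x"
        using 4 by (intro id_outside_supp) auto
      show ?thesis
      proof (cases "b x = x")
        case True
        define y where "y = inv' a x"
        have y: "a y = x" "y \<noteq> p" using ia[of x y] y_def 4 by auto
        have "b y = y" using one[of y] y True by fastforce
        moreover have "inv' b x = x" using ib True by simp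
        ultimately show ?thesis using c y y_def by simp
      next
        case False
        then have ax: "a x = x" using one 4 by blast
        define y where "y = inv' b x"
        have y: "b y = x" "y \<noteq> p" using ib[of x y] y_def 4 by auto
        have "a y = y" using one[of y] y False by fastforce
        then have "inv' a y = y" using ia by simp
        then show ?thesis using c y y_def ax by simp
      qed
    qed
  qed
  then show "(a \<circ> b \<circ> inv' a \<circ> inv' b) x = cycle_of_list [p, a p, b p] x" by simp
qed

section \<open>Three-cycles in a set of maps closed under composition and inverses\<close>

locale permutation_set =
  fixes H :: "('a \<Rightarrow> 'a) set"
  assumes comp: "f \<in> H \<Longrightarrow> g \<in> H \<Longrightarrow> f \<circ> g \<in> H"
    and inv_closed: "f \<in> H \<Longrightarrow> inv' f \<in> H"
begin

definition has_cycle :: "'a \<Rightarrow> 'a \<Rightarrow> 'a \<Rightarrow> bool" where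
  "has_cycle x y z \<longleftrightarrow> distinct [x, y, z] \<and> cycle_of_list [x, y, z] \<in> H"

text \<open>Reflexivity is built in so that this becomes an equivalence relation. Within one class
  every three distinct points carry a three-cycle of \<open>H\<close>, see
  \<open>linked_imp_has_cycle\<close>.\<close>

definition linked :: "'a \<Rightarrow> 'a \<Rightarrow> bool" where
  "linked x y \<longleftrightarrow> x = y \<or> (\<exists>z. has_cycle x y z)"

lemma has_cycle_rotate: "has_cycle x y z \<Longrightarrow> has_cycle y z x"
  using cycle_of_list_rotate_independent[of "[x, y, z]" 1]
  by (auto simp: has_cycle_def simp del: cycle_of_list.simps)

lemma has_cycle_reverse:
  assumes "has_cycle x y z"
  shows "has_cycle z y x"
proof -
  have "inv' (cycle_of_list [x, y, z]) = cycle_of_list [z, y, x]"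
    by (intro inv_unique_comp)
       (simp_all add: fun_eq_iff transpose_commute[of z y] transpose_commute[of y x])
  then show ?thesis using assms inv_closed[of "cycle_of_list [x, y, z]"]
    by (auto simp: has_cycle_def simp del: cycle_of_list.simps)
qed

lemma has_cycle_swap: "has_cycle x y z \<Longrightarrow> has_cycle y x z"
  by (metis has_cycle_rotate has_cycle_reverse)

lemma has_cycle_swap': "has_cycle x y z \<Longrightarrow> has_cycle x z y"
  by (metis has_cycle_rotate has_cycle_reverse)

text \<open>\<open>g\<close> only has to normalise \<open>H\<close>, not to lie in it. This lets
  arbitrary turns of the cube transport cycles supported on the orbit.\<close>

lemma has_cycle_map:
  assumes "bij g" "\<And>h. h \<in> H \<Longrightarrow> g \<circ> h \<circ> inv' g \<in> H" "has_cycle x y z"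
  shows "has_cycle (g x) (g y) (g z)"
  using assms(2,3) conjugation_of_cycle[OF _ assms(1), of "[x, y, z]"] bij_is_inj[OF assms(1)]
  by (fastforce simp: has_cycle_def inj_eq simp del: cycle_of_list.simps)

lemma three_cycle_apply:
  assumes "has_cycle a b c"
  shows "cycle_of_list [a, b, c] a = b" "cycle_of_list [a, b, c] b = c"
    "cycle_of_list [a, b, c] c = a"
    "x \<noteq> a \<Longrightarrow> x \<noteq> b \<Longrightarrow> x \<noteq> c \<Longrightarrow> cycle_of_list [a, b, c] x = x"
  using assms unfolding has_cycle_def by auto

lemma has_cycle_conj:
  assumes "has_cycle a b c" "has_cycle x y z"
  defines "g \<equiv> cycle_of_list [a, b, c]"
  shows "has_cycle (g x) (g y) (g z)"
proof (rule has_cycle_map[where g = g])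
  show "bij g" unfolding g_def by (rule permutation_bijective[OF permutation_of_cycle])
  fix h assume "h \<in> H"
  then show "g \<circ> h \<circ> inv' g \<in> H"
    using assms(1) comp inv_closed unfolding has_cycle_def g_def by blast
qed fact

text \<open>Conjugating the cycle of \<open>x\<close>, \<open>y\<close>, \<open>u\<close> by the
  cycle of \<open>x\<close>, \<open>y\<close>, \<open>v\<close> sends \<open>x\<close> to
  \<open>y\<close> and \<open>y\<close> to \<open>v\<close> and leaves \<open>u\<close> in
  place.\<close>

lemma has_cycle_share_two:
  assumes "has_cycle x y u" "has_cycle x y v" "u \<noteq> v"
  shows "has_cycle y v u"
proof -
  have "u \<noteq> x" "u \<noteq> y" using assms(1) by (auto simp: has_cycle_def)
  then show ?thesis
    using has_cycle_conj[OF assms(2,1)] assms(3) unfolding three_cycle_apply(1,2)[OF assms(2)]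
    by (metis three_cycle_apply(4)[OF assms(2)])
qed

lemma linked_sym: "linked x y \<Longrightarrow> linked y x"
  using has_cycle_swap unfolding linked_def by blast

lemma linked_trans:
  assumes "linked x y" "linked y w"
  shows "linked x w"
proof (cases "x = y \<or> y = w \<or> x = w")
  case True
  then show ?thesis using assms by (auto simp: linked_def)
next
  case False
  then obtain z v where z: "has_cycle x y z" and v: "has_cycle y w v"
    using assms by (auto simp: linked_def)
  \<comment> \<open>In the first two cases a known cycle already contains \<open>x\<close> and
    \<open>w\<close>. In the third the cycles share \<open>y\<close> and \<open>z\<close>. In the
    last, conjugation by the cycle of \<open>y\<close>, \<open>w\<close>, \<open>v\<close> moves
    \<open>y\<close> to \<open>w\<close> and fixes \<open>x\<close> and \<open>z\<close>.\<close>
  consider "w = z" | "v = x" | "v = z" "w \<noteq> z" | "v \<noteq> x" "v \<noteq> z" "w \<noteq> z" by blast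
  then have "\<exists>t. has_cycle x w t"
  proof cases
    case 1
    then show ?thesis using has_cycle_swap'[OF z] by blast
  next
    case 2
    then show ?thesis using has_cycle_reverse[OF v] has_cycle_swap' by blast
  next
    case 3
    have "has_cycle y z x" "has_cycle y z w"
      using has_cycle_rotate[OF z] has_cycle_swap'[OF v] 3 by auto
    then have "has_cycle z w x" using False by (rule_tac has_cycle_share_two) auto
    then show ?thesis using has_cycle_reverse has_cycle_swap' by blast
  next
    case 4
    have "x \<noteq> y" "z \<noteq> y" using z by (auto simp: has_cycle_def)
    then show ?thesis using has_cycle_conj[OF v z] False 4
      by (metis three_cycle_apply(1,4)[OF v])
  qed
  then show ?thesis by (simp add: linked_def)
qed

lemma linked_map:
  assumes "bij g" "\<And>h. h \<in> H \<Longrightarrow> g \<circ> h \<circ> inv' g \<in> H" "linked x y"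
  shows "linked (g x) (g y)"
  using has_cycle_map[OF assms(1,2)] assms(3) by (auto simp: linked_def)

text \<open>The links supply cycles with uncontrolled third points \<open>u\<close> and
  \<open>v\<close>. Conjugation and \<open>has_cycle_share_two\<close> exchange these for the
  prescribed points.\<close>

lemma linked_imp_has_cycle:
  assumes "linked x y" "linked y z" "distinct [x, y, z]"
  shows "has_cycle x y z"
proof -
  obtain u v where u: "has_cycle x y u" and v: "has_cycle y z v"
    using assms by (auto simp: linked_def)
  consider "u = z" | "v = x" | "u = v" "u \<noteq> z" | "u \<noteq> v" "u \<noteq> z" "v \<noteq> x" by blast
  then show ?thesis
  proof cases
    case 1
    then show ?thesis using u by simp
  next
    case 2
    then show ?thesis using has_cycle_rotate[OF has_cycle_rotate[OF v]] by simp
  next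
    case 3
    have "has_cycle u y x" "has_cycle u y z"
      using has_cycle_reverse[OF u] has_cycle_rotate[OF has_cycle_rotate[OF v]] 3 by auto
    then have "has_cycle y z x" using assms(3) by (rule_tac has_cycle_share_two) auto
    then show ?thesis using has_cycle_rotate by blast
  next
    case 4
    \<comment> \<open>Conjugation by the cycle of \<open>y\<close>, \<open>z\<close>,
      \<open>v\<close> turns the cycle of \<open>x\<close>, \<open>y\<close>, \<open>u\<close> into
      one of \<open>x\<close>, \<open>z\<close>, \<open>u\<close>. The two share \<open>u\<close>
      and \<open>x\<close>.\<close>
    have "x \<noteq> y" "x \<noteq> z" "u \<noteq> y" using u assms(3) by (auto simp: has_cycle_def)
    then have "has_cycle x z u"
      using has_cycle_conj[OF v u] 4 by (metis three_cycle_apply(1,4)[OF v])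
    then have "has_cycle u x y" "has_cycle u x z"
      using has_cycle_rotate[OF has_cycle_rotate] u by blast+
    then have "has_cycle x z y" using assms(3) by (rule_tac has_cycle_share_two) auto
    then show ?thesis by (rule has_cycle_swap')
  qed
qed

end

text \<open>Cycle lengths divide 4 and differ from 2, so every nontrivial cycle has length 4 and is
  odd. The number \<open>m\<close> counts these cycles, and the induction removes one of them at a
  time.\<close>

lemma evenperm_four_cycles:
  assumes "finite A" "p permutes A"
    and "\<And>x. p x \<noteq> x \<Longrightarrow> p (p x) \<noteq> x" and "\<And>x. p (p (p (p x))) = x"
  shows "\<exists>m. card {x. p x \<noteq> x} = 4 * m \<and> (evenperm p \<longleftrightarrow> even m)"
  using assms(2-)
proof (induction "card {x. p x \<noteq> x}" arbitrary: p rule: less_induct)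
  case less
  have fin: "finite {x. p x \<noteq> x}"
    using less.prems(1) assms(1) by (rule_tac finite_subset[of _ A]) (auto simp: permutes_def)
  show ?case
  proof (cases "\<exists>x. p x \<noteq> x")
    case False
    then have "p = id" by auto
    then show ?thesis by (intro exI[of _ 0]) auto
  next
    case True
    then obtain x where x: "p x \<noteq> x" by blast
    define y z w where "y = p x" "z = p y" "w = p z"
    have inj: "p a = p b \<longleftrightarrow> a = b" for a b
      using permutes_inj[OF less.prems(1)] by (simp add: inj_eq)
    have p: "p x = y" "p y = z" "p z = w" "p w = x"
      using less.prems(3)[of x] by (simp_all add: y_z_w_def)
    have yx: "y \<noteq> x" and zy: "z \<noteq> y" and wz: "w \<noteq> z"
      using x p inj by metis+
    have "z \<noteq> x" "w \<noteq> y"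
      using less.prems(2)[of x] less.prems(2)[of y] x zy p by auto
    moreover have "w \<noteq> x" using yx p by metis
    ultimately have d: "distinct [x, y, z, w]" using yx zy wz by auto
    \<comment> \<open>\<open>q\<close> is \<open>p\<close> with the four-cycle through
      \<open>x\<close> replaced by fixed points, so its support is smaller by four.\<close>
    define q where "q v = (if v \<in> {x, y, z, w} then v else p v)" for v
    have img: "p v \<in> {x, y, z, w} \<longleftrightarrow> v \<in> {x, y, z, w}" for v
      using p inj by (metis empty_iff insert_iff)
    have pq: "p = cycle_of_list [x, y, z, w] \<circ> q"
    proof
      fix v
      show "p v = (cycle_of_list [x, y, z, w] \<circ> q) v"
      proof (cases "v \<in> {x, y, z, w}")
        case True
        then show ?thesis using p d by (auto simp: q_def)
      next
        case False
        then show ?thesis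
          using id_outside_supp[of "p v" "[x, y, z, w]"] img[of v]
          by (simp add: q_def del: cycle_of_list.simps)
      qed
    qed
    have q_perm: "q permutes A"
    proof -
      have "bij q"
      proof -
        have b: "bij (cycle_of_list [x, y, z, w])"
          by (rule permutation_bijective[OF permutation_of_cycle])
        have "q = inv' (cycle_of_list [x, y, z, w]) \<circ> p"
          using b by (simp add: pq comp_assoc[symmetric] bij_is_inj del: cycle_of_list.simps)
        then show ?thesis
          using b permutes_bij[OF less.prems(1)] by (metis bij_comp bij_imp_bij_inv)
      qed
      moreover have "\<And>x. x \<notin> A \<Longrightarrow> q x = x"
        using less.prems(1) by (simp add: q_def permutes_def)
      ultimately show ?thesis
        unfolding permutes_def bij_iff by blast
    qed
    have supp: "{v. p v \<noteq> v} = {v. q v \<noteq> v} \<union> {x, y, z, w}"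
      using p d by (auto simp: q_def)
    have disj: "{v. q v \<noteq> v} \<inter> {x, y, z, w} = {}" by (auto simp: q_def)
    have fq: "finite {v. q v \<noteq> v}" using fin unfolding supp by simp
    have c: "card {v. p v \<noteq> v} = card {v. q v \<noteq> v} + 4"
      unfolding supp using d by (subst card_Un_disjoint[OF fq _ disj]) auto
    have "\<exists>m. card {x. q x \<noteq> x} = 4 * m \<and> (evenperm q \<longleftrightarrow> even m)"
    proof (rule less.hyps)
      show "card {x. q x \<noteq> x} < card {x. p x \<noteq> x}" using c by simp
      show "q permutes A" by (rule q_perm)
      show "q (q (q (q v))) = v" for v
        using less.prems(3) img by (auto simp: q_def)
      show "q (q v) \<noteq> v" if "q v \<noteq> v" for v
        using that less.prems(2) img by (auto simp: q_def split: if_splits)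
    qed
    then obtain m where m: "card {x. q x \<noteq> x} = 4 * m" "evenperm q \<longleftrightarrow> even m" by blast
    have "evenperm p \<longleftrightarrow> \<not> evenperm q"
    proof -
      have pq': "permutation q" using q_perm assms(1) permutation_permutes by blast
      have "\<not> evenperm (cycle_of_list [x, y, z, w])"
        using d by (simp add: evenperm_comp evenperm_swap permutation_compose permutation_swap_id)
      then show ?thesis
        unfolding pq evenperm_comp[OF permutation_of_cycle pq'] by blast
    qed
    then show ?thesis using m c by (intro exI[of _ "Suc m"]) auto
  qed
qed

subsection \<open>Slice turns as permutations\<close>

text \<open>\<open>restrict\<close> yields \<open>undefined\<close> outside
  \<open>facelets n\<close>. Extending by the identity instead gives total permutations, to which
  composition, inverses and signs apply directly.\<close>

definition turn :: "nat \<Rightarrow> face \<Rightarrow> nat \<Rightarrow> facelet \<Rightarrow> facelet" where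
  "turn n X k = restrict_id (slice_turn n X k) (facelets n)"

lemma finite_facelets: "finite (facelets n)"
proof -
  have "(UNIV :: face set) \<subseteq> {Up, Down, Front, Back, Right, Left}"
    using face.exhaust by auto
  then have "finite (UNIV :: face set)" by (rule finite_subset) simp
  then show ?thesis by (simp add: facelets_def)
qed

lemma in_facelets: "(f, r, c) \<in> facelets n \<longleftrightarrow> 1 \<le> r \<and> r \<le> n \<and> 1 \<le> c \<and> c \<le> n"
  by (auto simp: facelets_def)

lemma turn_apply: "x \<in> facelets n \<Longrightarrow> turn n X k x = slice_turn n X k x"
  by (simp add: turn_def)

lemma turn_outside: "x \<notin> facelets n \<Longrightarrow> turn n X k x = x"
  by (simp add: turn_def)

text \<open>The bound \<open>(n + 1) div 2\<close> admits the middle slice of an odd cube. It is not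
  among the generators, but the lower bound needs it.\<close>

lemma turn_in_facelets_and_order_four:
  assumes "2 \<le> n" "1 \<le> k" "k \<le> (n + 1) div 2"
  shows "turn n X k x \<in> facelets n \<longleftrightarrow> x \<in> facelets n"
    and "turn n X k (turn n X k (turn n X k (turn n X k x))) = x"
proof -
  obtain f r c where x: "x = (f, r, c)" by (cases x)
  have in_F: "slice_turn n X k x \<in> facelets n" if "x \<in> facelets n" for x
  proof -
    obtain f r c where x: "x = (f, r, c)" by (cases x)
    show ?thesis using that assms unfolding x
      by (cases X; cases f) (auto simp: slice_turn_def in_facelets)
  qed
  show "turn n X k x \<in> facelets n \<longleftrightarrow> x \<in> facelets n"
    using in_F by (cases "x \<in> facelets n") (auto simp: turn_apply turn_outside)
  show "turn n X k (turn n X k (turn n X k (turn n X k x))) = x"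
  proof (cases "x \<in> facelets n")
    case True
    then have "slice_turn n X k (slice_turn n X k (slice_turn n X k (slice_turn n X k x))) = x"
      using assms unfolding x
      by (cases X; cases f) (auto simp: slice_turn_def in_facelets)
    then show ?thesis using True in_F by (simp add: turn_apply)
  qed (simp add: turn_outside)
qed

lemma turn_permutes:
  assumes "2 \<le> n" "1 \<le> k" "k \<le> (n + 1) div 2"
  shows "turn n X k permutes facelets n"
proof -
  let ?t = "turn n X k"
  have "bij ?t"
    by (rule o_bij[where g = "?t \<circ> ?t \<circ> ?t"])
       (auto simp: fun_eq_iff turn_in_facelets_and_order_four(2)[OF assms])
  then show ?thesis
    unfolding permutes_def bij_iff using turn_outside by blast
qed

text \<open>Products of turns without inverses: a turn has order four, so its inverse is its cube,
  and \<open>moves_inv\<close> recovers closure under inverses.\<close>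

inductive_set moves :: "nat \<Rightarrow> (facelet \<Rightarrow> facelet) set" for n where
  id: "id \<in> moves n"
| turn: "g \<in> moves n \<Longrightarrow> 1 \<le> k \<Longrightarrow> k \<le> n div 2 \<Longrightarrow> turn n X k \<circ> g \<in> moves n"

lemma moves_permutes: "g \<in> moves n \<Longrightarrow> g permutes facelets n"
proof (induction rule: moves.induct)
  case (turn g k X)
  then have "turn n X k permutes facelets n" by (intro turn_permutes) auto
  then show ?case using turn by (intro permutes_compose)
qed (rule permutes_id)

lemma turn_in_moves: "1 \<le> k \<Longrightarrow> k \<le> n div 2 \<Longrightarrow> turn n X k \<in> moves n"
  using moves.turn[OF moves.id, of k n X] by simp

lemma moves_comp: "g \<in> moves n \<Longrightarrow> h \<in> moves n \<Longrightarrow> g \<circ> h \<in> moves n"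
  by (induction rule: moves.induct) (auto simp: comp_assoc intro: moves.turn)

lemma inv_turn:
  assumes "2 \<le> n" "1 \<le> k" "k \<le> (n + 1) div 2"
  shows "inv' (turn n X k) = turn n X k \<circ> turn n X k \<circ> turn n X k"
  by (rule inv_unique_comp)
     (auto simp: fun_eq_iff turn_in_facelets_and_order_four(2)[OF assms])

lemma moves_inv: "g \<in> moves n \<Longrightarrow> inv' g \<in> moves n"
proof (induction rule: moves.induct)
  case id
  show ?case unfolding inv_id by (rule moves.id)
next
  case (turn g k X)
  have t: "turn n X k \<in> moves n" using turn by (intro turn_in_moves)
  have "inv' (turn n X k \<circ> g) = inv' g \<circ> inv' (turn n X k)"
    using t turn.hyps(1) by (intro o_inv_distrib permutes_bij[OF moves_permutes])
  also have "inv' (turn n X k) = turn n X k \<circ> turn n X k \<circ> turn n X k"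
    using turn by (intro inv_turn) auto
  finally show ?case using moves_comp[OF turn.IH moves_comp[OF moves_comp[OF t t] t]] by metis
qed

section \<open>Passage between total permutations and the group \<open>rubik_group\<close>\<close>

lemma restrict_in_Bij: "g permutes A \<Longrightarrow> restrict g A \<in> Bij A"
  by (simp add: Bij_def permutes_imp_bij)

lemma restrict_mult:
  assumes "g permutes A" "h permutes A"
  shows "restrict g A \<otimes>\<^bsub>BijGroup A\<^esub> restrict h A = restrict (g \<circ> h) A"
proof -
  have "restrict g A \<otimes>\<^bsub>BijGroup A\<^esub> restrict h A = compose A (restrict g A) (restrict h A)"
    using assms by (simp add: BijGroup_def restrict_in_Bij)
  also have "\<dots> = restrict (g \<circ> h) A"
    using permutes_in_image[OF assms(2)] by (auto simp: compose_def fun_eq_iff)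
  finally show ?thesis .
qed

lemma restrict_inj:
  assumes "g permutes A" "h permutes A" "restrict g A = restrict h A"
  shows "g = h"
proof
  fix x
  show "g x = h x"
    using assms by (cases "x \<in> A") (auto simp: permutes_def dest: fun_cong[of _ _ x])
qed

lemma restrict_turn: "restrict (turn n X k) (facelets n) = restrict (slice_turn n X k) (facelets n)"
  by (auto simp: turn_apply)

lemma carrier_rubik_group_moves:
  "carrier (rubik_group n) = (\<lambda>g. restrict g (facelets n)) ` moves n"
proof -
  let ?B = "BijGroup (facelets n)" and ?r = "\<lambda>g. restrict g (facelets n)"
  interpret group ?B by (rule group_BijGroup)
  have mult: "?r g \<otimes>\<^bsub>?B\<^esub> ?r h = ?r (g \<circ> h)" if "g \<in> moves n" "h \<in> moves n" for g h
    using that by (intro restrict_mult moves_permutes)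
  have carr: "?r g \<in> carrier ?B" if "g \<in> moves n" for g
    using restrict_in_Bij[OF moves_permutes[OF that]] by (simp add: BijGroup_def)
  have one: "\<one>\<^bsub>?B\<^esub> = ?r id" by (simp add: BijGroup_def id_def)
  have gen: "\<exists>t \<in> moves n. h = ?r t" if h: "h \<in> slice_turns n" for h
  proof -
    obtain X k where "1 \<le> k" "k \<le> n div 2" "h = ?r (slice_turn n X k)"
      using h unfolding slice_turns_def by blast
    then show ?thesis using turn_in_moves restrict_turn by metis
  qed
  have "generate ?B (slice_turns n) \<subseteq> ?r ` moves n"
  proof
    fix x assume "x \<in> generate ?B (slice_turns n)"
    then show "x \<in> ?r ` moves n"
    proof (induction rule: generate.induct)
      case one
      then show ?case using moves.id \<open>\<one>\<^bsub>?B\<^esub> = ?r id\<close> by blast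
    next
      case (incl h)
      then show ?case using gen by blast
    next
      case (inv h)
      then obtain t where t: "t \<in> moves n" "h = ?r t" using gen by blast
      have "?r (inv' t) \<otimes>\<^bsub>?B\<^esub> h = \<one>\<^bsub>?B\<^esub>"
        unfolding t(2) mult[OF moves_inv[OF t(1)] t(1)] one
        using permutes_inv_o(2)[OF moves_permutes[OF t(1)]] by simp
      then have "inv\<^bsub>?B\<^esub> h = ?r (inv' t)"
        using t carr moves_inv by (intro inv_equality) auto
      then show ?case using moves_inv[OF t(1)] by blast
    next
      case (eng h1 h2)
      then obtain g h where "g \<in> moves n" "h1 = ?r g" "h \<in> moves n" "h2 = ?r h" by blast
      then show ?case using mult moves_comp by blast
    qed
  qed
  moreover have "?r g \<in> generate ?B (slice_turns n)" if "g \<in> moves n" for g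
    using that
  proof (induction rule: moves.induct)
    case id
    then show ?case unfolding one[symmetric] by (rule generate.one)
  next
    case (turn g k X)
    have "?r (turn n X k) \<in> generate ?B (slice_turns n)"
      unfolding restrict_turn using turn by (intro generate.incl) (auto simp: slice_turns_def)
    then have "?r (turn n X k) \<otimes>\<^bsub>?B\<^esub> ?r g \<in> generate ?B (slice_turns n)"
      using turn.IH by (rule generate.eng)
    then show ?case
      unfolding mult[OF turn_in_moves[OF turn.hyps(2,3)] turn.hyps(1)] .
  qed
  ultimately show ?thesis unfolding carrier_rubik_group by blast
qed

lemma mult_rubik_group: "g \<otimes>\<^bsub>rubik_group n\<^esub> h = g \<otimes>\<^bsub>BijGroup (facelets n)\<^esub> h"
  by (simp add: rubik_group_def subgroup_generated_def)

subsection \<open>Parity on rotation-closed sets of positions\<close>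

text \<open>In the chosen net, a facelet carried to a neighbouring face has its coordinates either
  kept or rotated by a multiple of a quarter turn. Hence closure under \<open>rot\<close> makes
  \<open>UNIV \<times> P\<close> invariant under every turn.\<close>

locale rotation_closed =
  fixes n :: nat and P :: "(nat \<times> nat) set"
  assumes sub: "P \<subseteq> {1..n} \<times> {1..n}"
    and rot: "(r, c) \<in> P \<Longrightarrow> (c, n + 1 - r) \<in> P"
begin

lemma bounds: "(r, c) \<in> P \<Longrightarrow> 1 \<le> r \<and> r \<le> n \<and> 1 \<le> c \<and> c \<le> n"
  using sub by auto

lemma rot2: "(r, c) \<in> P \<Longrightarrow> (n + 1 - r, n + 1 - c) \<in> P"
  using rot by blast

lemma rot3: "(r, c) \<in> P \<Longrightarrow> (n + 1 - c, r) \<in> P"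
  using rot[OF rot2] bounds by fastforce

lemma in_facelets_P: "UNIV \<times> P \<subseteq> facelets n"
  using sub by (auto simp: facelets_def)

lemma finite_P: "finite (UNIV \<times> P :: facelet set)"
  using in_facelets_P finite_facelets by (rule finite_subset)

lemma turn_P:
  assumes "x \<in> UNIV \<times> P"
  shows "turn n X k x \<in> UNIV \<times> P"
proof -
  obtain f r c where x: "x = (f, r, c)" by (cases x)
  have P: "(r, c) \<in> P" using assms x by simp
  have "slice_turn n X k x \<in> UNIV \<times> P"
    unfolding x using P rot[OF P] rot2[OF P] rot3[OF P] bounds[OF P]
    by (cases X; cases f) (auto simp: slice_turn_def)
  moreover have "turn n X k x = slice_turn n X k x"
    using assms in_facelets_P by (intro turn_apply) auto
  ultimately show ?thesis by simp
qed

lemma moves_P: "g \<in> moves n \<Longrightarrow> x \<in> UNIV \<times> P \<Longrightarrow> g x \<in> UNIV \<times> P"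
  by (induction rule: moves.induct) (simp_all only: id_apply comp_apply turn_P)

lemma moves_bij_betw: "g \<in> moves n \<Longrightarrow> bij_betw g (UNIV \<times> P) (UNIV \<times> P)"
proof -
  assume g: "g \<in> moves n"
  have "inj_on g (UNIV \<times> P)"
    using permutes_inj[OF moves_permutes[OF g]] by (rule inj_on_subset) simp
  moreover from this have "g ` (UNIV \<times> P) = UNIV \<times> P"
    using moves_P[OF g] by (intro endo_inj_surj finite_P image_subsetI)
  ultimately show ?thesis by (simp add: bij_betw_def)
qed

text \<open>The lines at distance \<open>k\<close> from the four borders of a face are rotations of
  one another, so for a rotation-closed \<open>P\<close> row \<open>k\<close> counts them
  all.\<close>

lemma card_lines:
  shows "card {(r, c) \<in> P. r = k} = card {c. (k, c) \<in> P}"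
    and "1 \<le> k \<Longrightarrow> k \<le> n \<Longrightarrow> card {(r, c) \<in> P. c = n + 1 - k} = card {c. (k, c) \<in> P}"
    and "1 \<le> k \<Longrightarrow> k \<le> n \<Longrightarrow> card {(r, c) \<in> P. r = n + 1 - k} = card {c. (k, c) \<in> P}"
    and "1 \<le> k \<Longrightarrow> k \<le> n \<Longrightarrow> card {(r, c) \<in> P. c = k} = card {c. (k, c) \<in> P}"
proof -
  show "card {(r, c) \<in> P. r = k} = card {c. (k, c) \<in> P}"
    by (rule bij_betw_same_card[of snd], rule bij_betw_byWitness[where f' = "\<lambda>c. (k, c)"]) auto
  assume k: "1 \<le> k" "k \<le> n"
  show "card {(r, c) \<in> P. c = n + 1 - k} = card {c. (k, c) \<in> P}"
    by (rule bij_betw_same_card[of fst],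
        rule bij_betw_byWitness[where f' = "\<lambda>c. (c, n + 1 - k)"])
       (use k in \<open>auto dest: rot rot3\<close>)
  show "card {(r, c) \<in> P. r = n + 1 - k} = card {c. (k, c) \<in> P}"
    by (rule bij_betw_same_card[of "\<lambda>(r, c). n + 1 - c"],
        rule bij_betw_byWitness[where f' = "\<lambda>c. (n + 1 - k, n + 1 - c)"])
       (use k in \<open>auto dest: rot2 bounds\<close>)
  show "card {(r, c) \<in> P. c = k} = card {c. (k, c) \<in> P}"
    by (rule bij_betw_same_card[of "\<lambda>(r, c). n + 1 - r"],
        rule bij_betw_byWitness[where f' = "\<lambda>c. (n + 1 - c, k)"])
       (use k in \<open>auto dest: rot rot3 bounds\<close>)
qed

lemma turn_on_P: "(r, c) \<in> P \<Longrightarrow> turn n X k (f, r, c) = slice_turn n X k (f, r, c)"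
  using bounds by (intro turn_apply) (simp add: in_facelets)

text \<open>The slice meets each of the four neighbouring faces in one line. The outer slice moves
  its own face as well, where only a central facelet could stay in place; \<open>center\<close>
  excludes it.\<close>

lemma card_moved:
  assumes k: "1 \<le> k" "k \<le> n div 2" and center: "\<And>r. (r, r) \<in> P \<Longrightarrow> 2 * r \<noteq> n + 1"
  shows "card {x \<in> UNIV \<times> P. turn n X k x \<noteq> x} =
    4 * card {c. (k, c) \<in> P} + (if k = 1 then card P else 0)"
proof -
  define L where "L f = {q \<in> P. turn n X k (f, q) \<noteq> (f, q)}" for f
  have L: "L f = {(r, c) \<in> P. slice_turn n X k (f, r, c) \<noteq> (f, r, c)}" for f
    by (auto simp: L_def turn_on_P)
  have UF: "(UNIV :: face set) = {Up, Down, Front, Back, Right, Left}"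
    using face.exhaust by auto
  have fin: "finite P" using sub finite_subset by blast
  have "{x \<in> UNIV \<times> P. turn n X k x \<noteq> x} = Sigma UNIV L"
    by (auto simp: L_def)
  then have "card {x \<in> UNIV \<times> P. turn n X k x \<noteq> x} = (\<Sum>f\<in>UNIV. card (L f))"
    using fin by (simp add: card_SigmaI UF L_def)
  also have "\<dots> = card (L Up) + card (L Down) + card (L Front) + card (L Back)
      + card (L Right) + card (L Left)"
    by (simp add: UF)
  also have "\<dots> = 4 * card {c. (k, c) \<in> P} + (if k = 1 then card P else 0)"
  proof -
    let ?top = "{(r, c) \<in> P. r = k}" and ?bottom = "{(r, c) \<in> P. r = n + 1 - k}"
      and ?left = "{(r, c) \<in> P. c = k}" and ?right = "{(r, c) \<in> P. c = n + 1 - k}"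
    let ?own = "if k = 1 then P else {}"
    have own: "L X = ?own"
    proof -
      have "slice_turn n X k (X, r, c) = (if k = 1 then (X, c, n + 1 - r) else (X, r, c))" for r c
        by (cases X) (simp_all add: slice_turn_def)
      moreover have "(c, n + 1 - r) \<noteq> (r, c)" if "(r, c) \<in> P" for r c
        using center[of r] bounds[OF that] that by auto
      ultimately show ?thesis unfolding L by auto
    qed
    have lines: "card ?top = card {c. (k, c) \<in> P}" "card ?bottom = card {c. (k, c) \<in> P}"
      "card ?left = card {c. (k, c) \<in> P}" "card ?right = card {c. (k, c) \<in> P}"
      using k by (intro card_lines; simp)+
    \<comment> \<open>The pairs \<open>(X, f)\<close> are sorted by the line in which the slice of
      \<open>X\<close> meets face \<open>f\<close>: top, bottom, left, right, or none if
      \<open>f\<close> is opposite to \<open>X\<close>.\<close>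
    have Ls: "L f = ?top" if "(X, f) \<in> {(Up, Front), (Up, Left), (Up, Back), (Up, Right),
        (Front, Down), (Back, Up)}" for f
      using that by (auto simp: L slice_turn_def split: if_splits)
    have Lb: "L f = ?bottom" if "(X, f) \<in> {(Down, Front), (Down, Left), (Down, Back), (Down, Right),
        (Front, Up), (Back, Down)}" for f
      using that by (auto simp: L slice_turn_def split: if_splits)
    have Ll: "L f = ?left" if "(X, f) \<in> {(Front, Right), (Back, Left), (Right, Back), (Left, Front),
        (Left, Down), (Left, Up)}" for f
      using that by (auto simp: L slice_turn_def split: if_splits)
    have Lr: "L f = ?right" if "(X, f) \<in> {(Front, Left), (Back, Right), (Left, Back), (Right, Front),
        (Right, Down), (Right, Up)}" for f
      using that by (auto simp: L slice_turn_def split: if_splits)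
    have Le: "L f = {}" if "(X, f) \<in> {(Up, Down), (Down, Up), (Left, Right), (Right, Left),
        (Front, Back), (Back, Front)}" for f
      using that by (auto simp: L slice_turn_def split: if_splits)
    note cards = Ls[THEN arg_cong[of _ _ card], unfolded lines]
      Lb[THEN arg_cong[of _ _ card], unfolded lines] Ll[THEN arg_cong[of _ _ card], unfolded lines]
      Lr[THEN arg_cong[of _ _ card], unfolded lines]
    show ?thesis
      using own by (cases X) (simp_all add: cards Le)
  qed
  finally show ?thesis .
qed

text \<open>On \<open>UNIV \<times> P\<close> the turn consists of disjoint four-cycles, so it is
  even as soon as the number of moved facelets is a multiple of 8.\<close>

lemma sign_on_turn:
  assumes k: "1 \<le> k" "k \<le> n div 2" and center: "\<And>r. (r, r) \<in> P \<Longrightarrow> 2 * r \<noteq> n + 1"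
    and dvd: "8 dvd 4 * card {c. (k, c) \<in> P} + (if k = 1 then card P else 0)"
  shows "sign_on (UNIV \<times> P) (turn n X k) = 1"
proof -
  let ?t = "restrict_id (turn n X k) (UNIV \<times> P)"
  have n: "2 \<le> n" "k \<le> (n + 1) div 2" using k by auto
  have perm: "?t permutes UNIV \<times> P"
    using moves_bij_betw[OF turn_in_moves[OF k]] by (intro bij_imp_permutes bij_betw_restrict_id) auto
  \<comment> \<open>Applied twice, the turn carries a facelet of the ring to another face and acts
    on its own outer face as a half turn, whose only fixed point would be the center.\<close>
  have tt: "?t (?t x) \<noteq> x" if "?t x \<noteq> x" for x
  proof -
    have xP: "x \<in> UNIV \<times> P" using that unfolding restrict_id_def by metis
    obtain f r c where x: "x = (f, r, c)" by (cases x)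
    have P: "(r, c) \<in> P" using xP x by simp
    have in_F: "x \<in> facelets n" "turn n X k x \<in> facelets n"
      using xP turn_P[OF xP] in_facelets_P by blast+
    have "?t x = slice_turn n X k x" "?t (?t x) = slice_turn n X k (slice_turn n X k x)"
      using xP turn_P[OF xP] in_F by (simp_all add: restrict_id_def turn_apply)
    then show ?thesis
      using that bounds[OF P] center[of r] P k unfolding x
      by (cases X; cases f) (auto simp: slice_turn_def split: if_splits)
  qed
  have four: "?t (?t (?t (?t x))) = x" for x
    using turn_P turn_in_facelets_and_order_four(2)[OF n(1) k(1) n(2)]
    by (cases "x \<in> UNIV \<times> P") (simp_all add: restrict_id_def del: mem_Sigma_iff)
  obtain m where m: "card {x. ?t x \<noteq> x} = 4 * m" "evenperm ?t \<longleftrightarrow> even m"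
    using evenperm_four_cycles[OF finite_P perm tt four] by blast
  have "{x. ?t x \<noteq> x} = {x \<in> UNIV \<times> P. turn n X k x \<noteq> x}"
    unfolding restrict_id_def by auto
  then have "8 dvd 4 * m" using card_moved[OF k center, of X] dvd m(1) by simp
  then have "even m" by presburger
  then show ?thesis using m(2) by (simp add: sign_on_def sign_def)
qed

lemma sign_on_moves:
  assumes "g \<in> moves n" and center: "\<And>r. (r, r) \<in> P \<Longrightarrow> 2 * r \<noteq> n + 1"
    and dvd: "\<And>k. 1 \<le> k \<Longrightarrow> k \<le> n div 2 \<Longrightarrow>
      8 dvd 4 * card {c. (k, c) \<in> P} + (if k = 1 then card P else 0)"
  shows "sign_on (UNIV \<times> P) g = 1"
  using assms(1)
proof (induction rule: moves.induct)
  case id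
  then show ?case by (rule sign_on_id)
next
  case (turn g k X)
  have "sign_on (UNIV \<times> P) (turn n X k \<circ> g) =
      sign_on (UNIV \<times> P) (turn n X k) * sign_on (UNIV \<times> P) g"
    using turn moves_bij_betw turn_in_moves finite_P by (intro sign_on_compose) auto
  then show ?case
    using turn sign_on_turn[OF turn.hyps(2,3) center dvd] by simp
qed

end

section \<open>The center edge orbit and its parity constraint\<close>

definition rotations :: "nat \<Rightarrow> nat \<Rightarrow> nat \<Rightarrow> (nat \<times> nat) set" where
  "rotations n a b = {(a, b), (b, n + 1 - a), (n + 1 - a, n + 1 - b), (n + 1 - b, a)}"

lemma rotation_closed_rotations:
  assumes "1 \<le> a" "a \<le> n" "1 \<le> b" "b \<le> n"
  shows "rotation_closed n (rotations n a b)"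
  using assms by unfold_locales (auto simp: rotations_def)

lemma rotation_closed_Un:
  assumes "rotation_closed n P" "rotation_closed n Q"
  shows "rotation_closed n (P \<union> Q)"
  using assms by (auto simp: rotation_closed_def)

locale center_edge =
  fixes n i j :: nat
  assumes n: "n \<ge> 5" and i: "2 \<le> i" "i \<le> n div 2" and j: "2 \<le> j" "j \<le> (n + 1) div 2"
    and ij: "j \<noteq> i"
begin

abbreviation "Q \<equiv> rotations n i j"
abbreviation "orb \<equiv> center_edge_orbit n i j"

lemma orb: "orb = UNIV \<times> Q"
  by (simp add: center_edge_orbit_def rotations_def)

sublocale Q: rotation_closed n Q
  using i j ij n by (intro rotation_closed_rotations) auto

text \<open>On the orbit alone a turn of slice \<open>i\<close> is a single four-cycle;
  \<open>rotations n 1 i\<close> supplies a second one, and \<open>rotations n 1 j\<close> does the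
  same for slice \<open>j\<close> unless that is the middle slice. The corners then make the count
  for the outer slices a multiple of 8.\<close>

definition parity_positions :: "(nat \<times> nat) set" where
  "parity_positions = Q \<union> rotations n 1 1 \<union> rotations n 1 i \<union>
     (if 2 * j = n + 1 then {} else rotations n 1 j)"

lemma rotation_closed_parity_positions: "rotation_closed n parity_positions"
proof -
  have "rotation_closed n {}" by (auto simp: rotation_closed_def)
  then show ?thesis
    unfolding parity_positions_def using n i j Q.rotation_closed_axioms
    by (simp add: rotation_closed_Un rotation_closed_rotations)
qed

lemma parity_positions_count:
  assumes k: "1 \<le> k" "k \<le> n div 2"
  shows "8 dvd 4 * card {c. (k, c) \<in> parity_positions} + (if k = 1 then card parity_positions else 0)"
proof -
  define i' j' where "i' = n + 1 - i" "j' = n + 1 - j"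
  show ?thesis
  proof (cases "2 * j = n + 1")
    case True
    then have j': "j' = j" unfolding i'_j'_def by simp
    have d: "distinct [1, i, j, i', n]" and kd: "k \<noteq> i'" "k \<noteq> j" "k \<noteq> n"
      using n i j ij k True unfolding i'_j'_def by auto
    have P: "parity_positions = {(i, j), (j, i'), (i', j), (j, i), (1, 1), (1, n), (n, n), (n, 1),
        (1, i), (i, n), (n, i'), (i', 1)}"
      using True j' unfolding parity_positions_def rotations_def i'_j'_def
      by (simp add: insert_commute)
    \<comment> \<open>The sum is 12 + 12 = 24 for \<open>k = 1\<close>, 8 for \<open>k = i\<close>
      and 0 for the remaining slices.\<close>
    have "card parity_positions = 12" using d unfolding P by (auto simp: card_insert_if)
    moreover have "{c. (k, c) \<in> parity_positions} =
        (if k = 1 then {1, n, i} else if k = i then {j, n} else {})"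
      using d kd unfolding P by auto
    ultimately show ?thesis using d by (cases "k = 1"; cases "k = i") auto
  next
    case False
    have d: "distinct [1, i, j, i', j', n]" and kd: "k \<noteq> i'" "k \<noteq> j'" "k \<noteq> n"
      using n i j ij k False unfolding i'_j'_def by auto
    have P: "parity_positions = {(i, j), (j, i'), (i', j'), (j', i), (1, 1), (1, n), (n, n), (n, 1),
        (1, i), (i, n), (n, i'), (i', 1), (1, j), (j, n), (n, j'), (j', 1)}"
      using False unfolding parity_positions_def rotations_def i'_j'_def
      by (simp add: insert_commute)
    \<comment> \<open>The sum is 16 + 16 = 32 for \<open>k = 1\<close>, 8 for \<open>k = i\<close>
      and for \<open>k = j\<close>, and 0 otherwise.\<close>
    have "card parity_positions = 16" using d unfolding P by (auto simp: card_insert_if)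
    moreover have "{c. (k, c) \<in> parity_positions} =
        (if k = 1 then {1, n, i, j} else if k = i then {j, n} else if k = j then {i', n} else {})"
      using d kd unfolding P by auto
    ultimately show ?thesis using d by (cases "k = 1"; cases "k = i"; cases "k = j") auto
  qed
qed

text \<open>The counterpart of \<open>Z_center_edge\<close> among total permutations;
  \<open>Z_eq_restrict_orbit_moves\<close> makes the connection.\<close>

definition orbit_moves :: "(facelet \<Rightarrow> facelet) set" where
  "orbit_moves = {g \<in> moves n. \<forall>x. x \<notin> orb \<longrightarrow> g x = x}"

lemma finite_orb: "finite orb"
  using Q.finite_P by (simp add: orb)

lemma orbit_moves_permutes: "g \<in> orbit_moves \<Longrightarrow> g permutes orb"
  using permutes_bij[OF moves_permutes, of g n] by (auto simp: orbit_moves_def permutes_def bij_iff)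

lemma orbit_moves_even:
  assumes "g \<in> orbit_moves"
  shows "evenperm g"
proof -
  interpret R: rotation_closed n parity_positions by (rule rotation_closed_parity_positions)
  have "sign_on (UNIV \<times> parity_positions) g = 1"
  proof (rule R.sign_on_moves)
    show "g \<in> moves n" using assms by (simp add: orbit_moves_def)
    show "2 * r \<noteq> n + 1" if "(r, r) \<in> parity_positions" for r
      using that n i j ij by (auto simp: parity_positions_def rotations_def split: if_splits)
  qed (rule parity_positions_count)
  \<comment> \<open>Nothing outside \<open>orb\<close> moves, so the sign on the larger set is the
    sign of \<open>g\<close> itself.\<close>
  moreover have "sign_on (UNIV \<times> parity_positions) g = sign g"
    using orbit_moves_permutes[OF assms] by (rule sign_on_permutes) (auto simp: orb parity_positions_def)
  ultimately show ?thesis by (simp add: sign_def split: if_splits)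
qed

lemma moves_orb: "g \<in> moves n \<Longrightarrow> g x \<in> orb \<longleftrightarrow> x \<in> orb"
proof -
  assume g: "g \<in> moves n"
  have "g (inv' g x) = x" "inv' g (g x) = x"
    using permutes_inverses[OF moves_permutes[OF g]] by auto
  then show ?thesis
    using Q.moves_P[OF g, of x] Q.moves_P[OF moves_inv[OF g], of "g x"] unfolding orb by metis
qed

sublocale permutation_set orbit_moves
proof
  fix f g assume fg: "f \<in> orbit_moves" "g \<in> orbit_moves"
  have "f \<circ> g \<in> moves n" using fg by (intro moves_comp) (auto simp: orbit_moves_def)
  moreover have "(f \<circ> g) x = x" if "x \<notin> orb" for x
    using fg that unfolding orbit_moves_def by (simp del: split_paired_All)
  ultimately show "f \<circ> g \<in> orbit_moves" unfolding orbit_moves_def by blast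
  show "inv' f \<in> orbit_moves"
    using fg(1) moves_inv permutes_not_in[OF permutes_inv[OF orbit_moves_permutes[OF fg(1)]]]
    unfolding orbit_moves_def by blast
qed

text \<open>Moves preserve \<open>orb\<close>, hence \<open>orbit_moves\<close> is normal in
  \<open>moves n\<close>. By \<open>has_cycle_map\<close>, links can therefore be moved around by
  any turn.\<close>

lemma orbit_moves_conj:
  assumes g: "g \<in> moves n" and h: "h \<in> orbit_moves"
  shows "g \<circ> h \<circ> inv' g \<in> orbit_moves"
proof -
  have "(g \<circ> h \<circ> inv' g) x = x" if "x \<notin> orb" for x
  proof -
    have "inv' g x \<notin> orb" using moves_orb[OF moves_inv[OF g]] that by simp
    then have "h (inv' g x) = inv' g x" using h unfolding orbit_moves_def by blast
    then show ?thesis using permutes_inverses(1)[OF moves_permutes[OF g]] by simp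
  qed
  moreover have "g \<circ> h \<circ> inv' g \<in> moves n"
    using g h by (intro moves_comp moves_inv) (auto simp: orbit_moves_def)
  ultimately show ?thesis unfolding orbit_moves_def by blast
qed

lemma moves_linked: "g \<in> moves n \<Longrightarrow> linked x y \<Longrightarrow> linked (g x) (g y)"
  using permutes_bij[OF moves_permutes] orbit_moves_conj by (rule linked_map)

end

subsection \<open>The middle slice\<close>

lemma turn_eq_if:
  "turn n X k (f, r, c) =
    (if 1 \<le> r \<and> r \<le> n \<and> 1 \<le> c \<and> c \<le> n then slice_turn n X k (f, r, c) else (f, r, c))"
  by (simp add: turn_def restrict_id_def in_facelets)

text \<open>For odd \<open>n\<close>, \<open>turns n X (n div 2)\<close> turns everything on the
  side of \<open>X\<close> up to the middle slice.\<close>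

primrec turns :: "nat \<Rightarrow> face \<Rightarrow> nat \<Rightarrow> facelet \<Rightarrow> facelet" where
  "turns n X 0 = id"
| "turns n X (Suc k) = turn n X (Suc k) \<circ> turns n X k"

lemma turns_in_moves: "k \<le> n div 2 \<Longrightarrow> turns n X k \<in> moves n"
proof (induction k)
  case 0
  show ?case unfolding turns.simps by (rule moves.id)
next
  case (Suc k)
  then show ?case unfolding turns.simps by (intro moves.turn) auto
qed

lemma turns_Left:
  assumes "k \<le> n div 2" "1 \<le> r" "r \<le> n" "1 \<le> c" "c \<le> n"
  shows "turns n Left k (Front, r, c) = (if c \<le> k then (Down, r, c) else (Front, r, c))"
    "turns n Left k (Down, r, c) = (if c \<le> k then (Back, n + 1 - r, n + 1 - c) else (Down, r, c))"
    "turns n Left k (Back, r, c) =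
      (if n + 1 - k \<le> c then (Up, n + 1 - r, n + 1 - c) else (Back, r, c))"
    "turns n Left k (Up, r, c) = (if c \<le> k then (Front, r, c) else (Up, r, c))"
    "turns n Left k (Left, r, c) = (if 1 \<le> k then (Left, c, n + 1 - r) else (Left, r, c))"
    "turns n Left k (Right, r, c) = (Right, r, c)"
  using assms
  by (induction k) (auto simp: turn_eq_if slice_turn_def)

lemma turns_Right:
  assumes "k \<le> n div 2" "1 \<le> r" "r \<le> n" "1 \<le> c" "c \<le> n"
  shows "turns n Right k (Front, r, c) = (if n + 1 - k \<le> c then (Up, r, c) else (Front, r, c))"
    "turns n Right k (Up, r, c) =
      (if n + 1 - k \<le> c then (Back, n + 1 - r, n + 1 - c) else (Up, r, c))"
    "turns n Right k (Back, r, c) = (if c \<le> k then (Down, n + 1 - r, n + 1 - c) else (Back, r, c))"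
    "turns n Right k (Down, r, c) = (if n + 1 - k \<le> c then (Front, r, c) else (Down, r, c))"
    "turns n Right k (Right, r, c) = (if 1 \<le> k then (Right, c, n + 1 - r) else (Right, r, c))"
    "turns n Right k (Left, r, c) = (Left, r, c)"
  using assms
  by (induction k) (auto simp: turn_eq_if slice_turn_def)

text \<open>The rotation of the whole cube in the direction of a clockwise turn of the Left face.\<close>

fun cube_rotation :: "nat \<Rightarrow> facelet \<Rightarrow> facelet" where
  "cube_rotation n (Front, r, c) = (Down, r, c)"
| "cube_rotation n (Down, r, c) = (Back, n + 1 - r, n + 1 - c)"
| "cube_rotation n (Back, r, c) = (Up, n + 1 - r, n + 1 - c)"
| "cube_rotation n (Up, r, c) = (Front, r, c)"
| "cube_rotation n (Left, r, c) = (Left, c, n + 1 - r)"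
| "cube_rotation n (Right, r, c) = (Right, n + 1 - c, r)"

lemma cube_rotation_in_facelets: "x \<in> facelets n \<Longrightarrow> cube_rotation n x \<in> facelets n"
  by (cases x; cases "fst x") (auto simp: in_facelets)

text \<open>Both sides turn the left half and the middle slice in the direction of Left and leave
  the right half alone: the turns of the Right slices undo the whole-cube rotation there.\<close>

lemma middle_turn_eq:
  assumes "2 \<le> n" "2 * m = n + 1" "x \<in> facelets n"
  shows "turns n Left (n div 2) (turn n Left m x) = turns n Right (n div 2) (cube_rotation n x)"
proof -
  obtain f r c where x: "x = (f, r, c)" by (cases x)
  have b: "1 \<le> r" "r \<le> n" "1 \<le> c" "c \<le> n" using assms(3) by (auto simp: x in_facelets)
  have h: "n div 2 = m - 1" "n = 2 * m - 1" "2 \<le> m" using assms by auto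
  show ?thesis
    unfolding x using b h
    by (cases f) (auto simp: turn_eq_if slice_turn_def turns_Left turns_Right)
qed

text \<open>The rotation takes the Up face to the Front face, so it conjugates one outer turn into
  the other.\<close>

lemma cube_rotation_turn:
  assumes "x \<in> facelets n"
  shows "cube_rotation n (turn n Up 1 x) = turn n Front 1 (cube_rotation n x)"
proof -
  obtain f r c where x: "x = (f, r, c)" by (cases x)
  have "cube_rotation n (slice_turn n Up 1 x) = slice_turn n Front 1 (cube_rotation n x)"
    using assms unfolding x by (cases f) (auto simp: in_facelets slice_turn_def)
  then show ?thesis using assms cube_rotation_in_facelets by (simp add: turn_apply)
qed

text \<open>By \<open>middle_turn_eq\<close> the middle turn is \<open>inv' a \<circ> b\<close>
  after the whole-cube rotation. Conjugating \<open>u\<close> by the rotation gives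
  \<open>f\<close>, so the rotation disappears and a product of moves remains.\<close>

lemma middle_turn_conj_in_moves:
  assumes "2 \<le> n" "2 * m = n + 1"
  shows "turn n Left m \<circ> turn n Up 1 \<circ> inv' (turn n Left m) \<in> moves n"
proof -
  define a b u f l where "a = turns n Left (n div 2)" "b = turns n Right (n div 2)"
    "u = turn n Up 1" "f = turn n Front 1" "l = turn n Left m"
  note defs = this
  have mv: "a \<in> moves n" "b \<in> moves n" "u \<in> moves n" "f \<in> moves n"
    using assms(1) unfolding defs by (auto intro!: turns_in_moves turn_in_moves)
  have l: "l permutes facelets n" unfolding defs using assms by (intro turn_permutes) auto
  note pa = moves_permutes[OF mv(1)] and pb = moves_permutes[OF mv(2)]
    and pu = moves_permutes[OF mv(3)] and pf = moves_permutes[OF mv(4)]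
  let ?g = "inv' a \<circ> b \<circ> f \<circ> inv' b \<circ> a"
  have "l \<circ> u \<circ> inv' l = ?g"
  proof
    fix x
    show "(l \<circ> u \<circ> inv' l) x = ?g x"
    proof (cases "x \<in> facelets n")
      case True
      define y where "y = inv' l x"
      have y: "y \<in> facelets n" "l y = x"
        using True l permutes_in_image[OF permutes_inv[OF l]] permutes_inverses(1)[OF l]
        by (auto simp: y_def)
      have uy: "u y \<in> facelets n" using y permutes_in_image[OF pu] by simp
      have 1: "a (l z) = b (cube_rotation n z)" if "z \<in> facelets n" for z
        using middle_turn_eq[OF assms that] unfolding defs .
      have "inv' b (a x) = cube_rotation n y"
        using 1[OF y(1)] y(2) permutes_inverses(2)[OF pb] by simp
      then have "b (f (inv' b (a x))) = b (cube_rotation n (u y))"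
        using cube_rotation_turn[OF y(1)] by (simp add: defs)
      also have "\<dots> = a (l (u y))" using 1[OF uy] by simp
      finally have "?g x = l (u y)" using permutes_inverses(2)[OF pa] by simp
      then show ?thesis by (simp add: y_def)
    next
      case False
      then show ?thesis
        using pa pb pu pf l permutes_inv[OF pa] permutes_inv[OF pb] permutes_inv[OF l]
        by (simp add: permutes_not_in)
    qed
  qed
  moreover have "?g \<in> moves n" using mv by (intro moves_comp moves_inv)
  ultimately show ?thesis unfolding defs by metis
qed

subsection \<open>Three-cycles in the orbit\<close>

context center_edge
begin

lemma bij_turn: "1 \<le> k \<Longrightarrow> k \<le> (n + 1) div 2 \<Longrightarrow> bij (turn n X k)"
  using n by (intro permutes_bij[OF turn_permutes]) auto

lemma turn_Right_Left_commute: "turn n Right i (turn n Left j x) = turn n Left j (turn n Right i x)"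
proof -
  obtain f r c where x: "x = (f, r, c)" by (cases x)
  \<comment> \<open>Since \<open>i + j \<le> n\<close>, the two parallel slices are
    disjoint.\<close>
  have "Suc n - i \<noteq> j" "Suc n - j \<noteq> i" using i j by auto
  then show ?thesis unfolding x using i j ij
    by (cases f) (auto simp: turn_eq_if slice_turn_def)
qed

lemma commutator_in_moves:
  defines "a \<equiv> turn n Right i" and "b \<equiv> turn n Up 1 \<circ> turn n Left j \<circ> inv' (turn n Up 1)"
  shows "a \<circ> b \<circ> inv' a \<circ> inv' b \<in> moves n"
proof -
  define u l where "u = turn n Up 1" "l = turn n Left j"
  have mv: "u \<in> moves n" "a \<in> moves n"
    using n i by (auto simp: u_l_def a_def intro!: turn_in_moves)
  show ?thesis
  proof (cases "j \<le> n div 2")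
    case True
    then have "l \<in> moves n" using j by (auto simp: u_l_def intro!: turn_in_moves)
    then have "b \<in> moves n" unfolding b_def u_l_def[symmetric]
      using mv by (intro moves_comp moves_inv)
    then show ?thesis using mv by (intro moves_comp moves_inv)
  next
    case False
    then have mid: "2 * j = n + 1" using j by auto
    \<comment> \<open>Since \<open>l\<close> commutes with \<open>a\<close>, it enters the commutator only through \<open>l u l\<^sup>-\<^sup>1\<close>.\<close>
    define v where "v = l \<circ> u \<circ> inv' l"
    have v: "v \<in> moves n"
      using middle_turn_conj_in_moves[OF _ mid] n unfolding v_def u_l_def by simp
    have bu: "bij u" and bl: "bij l" and ba: "bij a"
      using n i j by (auto simp: u_l_def a_def intro!: bij_turn)
    have ib: "inv' b = u \<circ> inv' l \<circ> inv' u"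
      unfolding b_def u_l_def[symmetric] using bu bl
      by (simp add: o_inv_distrib bij_comp bij_imp_bij_inv inv_inv_eq comp_assoc)
    have iv: "inv' v = l \<circ> inv' u \<circ> inv' l"
      unfolding v_def using bu bl
      by (simp add: o_inv_distrib bij_comp bij_imp_bij_inv inv_inv_eq comp_assoc)
    have al: "inv' a (l w) = l (inv' a w)" for w
      using turn_Right_Left_commute[of "inv' a w"] bij_inv_eq_iff[OF ba]
      unfolding a_def[symmetric] u_l_def[symmetric] by metis
    \<comment> \<open>Since \<open>inv' l \<circ> inv' a \<circ> l\<close> is \<open>inv' a\<close>,
      the conjugate \<open>inv' v \<circ> inv' a \<circ> v\<close> equals
      \<open>l \<circ> inv' u \<circ> inv' a \<circ> u \<circ> inv' l\<close>, the inner part of the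
      commutator.\<close>
    have "(a \<circ> b \<circ> inv' a \<circ> inv' b) x = (a \<circ> u \<circ> inv' v \<circ> inv' a \<circ> v \<circ> inv' u) x" for x
      unfolding ib iv unfolding v_def b_def u_l_def[symmetric]
      using al bl by (simp add: bij_is_inj)
    then have "a \<circ> b \<circ> inv' a \<circ> inv' b = a \<circ> u \<circ> inv' v \<circ> inv' a \<circ> v \<circ> inv' u" by blast
    moreover have "a \<circ> u \<circ> inv' v \<circ> inv' a \<circ> v \<circ> inv' u \<in> moves n"
      using mv v by (intro moves_comp moves_inv)
    ultimately show ?thesis by metis
  qed
qed

text \<open>On Up, \<open>a\<close> moves column \<open>n + 1 - i\<close> and \<open>b\<close> moves
  row \<open>j\<close>; they cross at \<open>p\<close>. On Front, Back and Down the lines moved are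
  different columns. On Left and Right, \<open>b\<close> moves facelets of row 1 only, and
  \<open>a\<close> moves nothing because \<open>i \<ge> 2\<close>.\<close>

lemma has_cycle_base: "has_cycle (Up, j, n + 1 - i) (Back, n + 1 - j, i) (Front, i, j)"
proof -
  define a u l where "a = turn n Right i" "u = turn n Up 1" "l = turn n Left j"
  define b where "b = u \<circ> l \<circ> inv' u"
  define p :: facelet where "p = (Up, j, n + 1 - i)"
  have bu: "bij u" and bl: "bij l" and ba: "bij a"
    using n i j by (auto simp: a_u_l_def intro!: bij_turn)
  have bb: "bij b" unfolding b_def using bu bl by (intro bij_comp bij_imp_bij_inv)
  have ap: "a p = (Back, n + 1 - j, i)"
    using n i j ij by (auto simp: a_u_l_def p_def turn_eq_if slice_turn_def)
  have "u (Up, i, j) = p"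
    using n i j ij by (auto simp: a_u_l_def p_def turn_eq_if slice_turn_def)
  then have "inv' u p = (Up, i, j)" using bu by (metis bij_inv_eq_iff)
  moreover have "u (l (Up, i, j)) = (Front, i, j)"
    using n i j ij by (auto simp: a_u_l_def turn_eq_if slice_turn_def)
  ultimately have bp: "b p = (Front, i, j)" by (simp add: b_def)
  have "a \<circ> b \<circ> inv' a \<circ> inv' b = cycle_of_list [p, a p, b p]"
  proof (rule commutator_three_cycle[OF ba bb])
    show "a p \<noteq> p" "b p \<noteq> p" unfolding ap bp by (simp_all add: p_def)
    fix x assume ax: "a x \<noteq> x" and bx: "b x \<noteq> x"
    \<comment> \<open>The support of \<open>b\<close> is the image under \<open>u\<close> of the
      support of \<open>l\<close>, so it is described through \<open>y\<close>.\<close>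
    define y where "y = inv' u x"
    have x: "x = u y" using bu by (simp add: y_def bij_is_surj surj_f_inv_f)
    have "b x = u (l y)" by (simp add: b_def y_def)
    then have ly: "l y \<noteq> y" using bx x by auto
    obtain f r c where y: "y = (f, r, c)" by (cases y)
    show "x = p"
      using ly ax n i j ij unfolding x y
      by (cases f) (auto simp: a_u_l_def p_def turn_eq_if slice_turn_def split: if_splits)
  qed
  then have "cycle_of_list [p, a p, b p] \<in> moves n"
    using commutator_in_moves by (simp only: a_u_l_def b_def)
  moreover have "p \<in> orb" "a p \<in> orb" "b p \<in> orb"
    unfolding ap bp by (auto simp: p_def orb rotations_def)
  then have "cycle_of_list [p, a p, b p] x = x" if "x \<notin> orb" for x
    using that by (intro id_outside_supp) auto
  ultimately have "cycle_of_list [p, a p, b p] \<in> orbit_moves" unfolding orbit_moves_def by blast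
  then show ?thesis unfolding ap bp by (simp add: has_cycle_def p_def)
qed

text \<open>The outer turn of face \<open>f\<close> permutes the four orbit positions on
  \<open>f\<close> cyclically and fixes \<open>y\<close>, so a link from one of them to
  \<open>y\<close> spreads to all four.\<close>

lemma linked_face:
  assumes "linked (f, r, c) y" "(r, c) \<in> Q" "y \<in> orb" "fst y \<noteq> f" "q \<in> Q"
  shows "linked (f, q) y"
proof -
  let ?t = "turn n f 1"
  have t: "?t \<in> moves n" using n by (intro turn_in_moves) auto
  obtain f' r' c' where y: "y = (f', r', c')" by (cases y)
  have "(r', c') \<in> Q" "f' \<noteq> f" using assms(3,4) by (auto simp: y orb)
  \<comment> \<open>Positions of \<open>Q\<close> keep off the border, so the outer turn of
    \<open>f\<close> reaches none of them on another face.\<close>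
  moreover from this have "r' \<noteq> 1" "r' \<noteq> n" "c' \<noteq> 1" "c' \<noteq> n"
    using n i j by (auto simp: rotations_def)
  ultimately have ty: "?t y = y"
    unfolding y turn_eq_if slice_turn_def by (cases f; cases f') simp_all
  have step: "linked (f, c, n + 1 - r) y" if "linked (f, r, c) y" "(r, c) \<in> Q" for r c
  proof -
    have "?t (f, r, c) = (f, c, n + 1 - r)"
      using Q.bounds[OF that(2)] by (simp add: turn_eq_if slice_turn_def)
    then show ?thesis using moves_linked[OF t that(1)] ty by metis
  qed
  have Q: "(c, n + 1 - r) \<in> Q" "(n + 1 - r, n + 1 - c) \<in> Q"
    using Q.rot[OF assms(2)] Q.rot2[OF assms(2)] by auto
  have "linked (f, c, n + 1 - r) y" using step assms by blast
  moreover from this have "linked (f, n + 1 - r, n + 1 - c) y" using step Q by blast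
  moreover from this have "linked (f, n + 1 - c, r) y"
    using step[OF _ Q(2)] Q.bounds[OF assms(2)] by fastforce
  moreover have "q \<in> {(r, c), (c, n + 1 - r), (n + 1 - r, n + 1 - c), (n + 1 - c, r)}"
  proof -
    have nn: "n + 1 - (n + 1 - i) = i" "n + 1 - (n + 1 - j) = j" using i j by auto
    \<comment> \<open>\<open>Q\<close> is a single rotation orbit, so rotating any of its members
      lists it completely.\<close>
    have "Q \<subseteq> {(r, c), (c, n + 1 - r), (n + 1 - r, n + 1 - c), (n + 1 - c, r)}"
      using assms(2) unfolding rotations_def
      by (elim insertE emptyE; simp only: prod.inject nn; blast)
    then show ?thesis using assms(5) by blast
  qed
  ultimately show ?thesis using assms(1) by auto
qed

text \<open>The turn carries \<open>(f, q0)\<close> to face \<open>f'\<close> and fixes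
  \<open>(f, q1)\<close>, so their link becomes one between the two faces. Passing through
  \<open>(f, q1)\<close> rather than \<open>y\<close> allows \<open>y\<close> to lie on
  \<open>f'\<close>.\<close>

lemma linked_adjacent_face:
  assumes f: "\<And>q. q \<in> Q \<Longrightarrow> linked (f, q) y" and "f' \<noteq> f"
    and "q0 \<in> Q" "q1 \<in> Q" "(r', c') \<in> Q"
    and t: "turn n X i (f, q0) = (f', r', c')" "turn n X i (f, q1) = (f, q1)"
    and "q \<in> Q"
  shows "linked (f', q) y"
proof -
  have "linked (f, q0) (f, q1)"
    using f[OF assms(3)] linked_sym[OF f[OF assms(4)]] by (rule linked_trans)
  then have "linked (turn n X i (f, q0)) (turn n X i (f, q1))"
    using i by (rule_tac moves_linked[OF turn_in_moves]) auto
  then have "linked (f', r', c') (f, q1)" unfolding t .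
  moreover have "(f, q1) \<in> orb" using assms(4) by (simp add: orb)
  moreover have "fst (f, q1) \<noteq> f'" using assms(2) by simp
  ultimately have "linked (f', q) (f, q1)" using linked_face assms(5,8) by blast
  then show ?thesis using f[OF assms(4)] by (rule linked_trans)
qed

text \<open>\<open>has_cycle_base\<close> links one facelet of Up to \<open>?y\<close>. The links
  spread over Up, from there to the four side faces (including Back, which contains
  \<open>?y\<close>), and from Front to Down.\<close>

lemma all_linked:
  assumes "x \<in> orb" "y \<in> orb"
  shows "linked x y"
proof -
  let ?y = "(Back, n + 1 - j, i) :: facelet"
  have Q: "(i, j) \<in> Q" "(j, n + 1 - i) \<in> Q" "(n + 1 - i, n + 1 - j) \<in> Q" "(n + 1 - j, i) \<in> Q"
    by (auto simp: rotations_def)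
  have "linked (Up, j, n + 1 - i) ?y" using has_cycle_base by (auto simp: linked_def)
  then have up_linked: "linked (Up, q) ?y" if "q \<in> Q" for q
    using Q(2) _ _ that by (rule linked_face) (use Q(4) in \<open>auto simp: orb\<close>)
  note turns = turn_eq_if slice_turn_def
  \<comment> \<open>In each application the first position lies on the line of the old face moved by
    slice \<open>i\<close> of \<open>X\<close>, the second lies off that line, and the third is
    where the first arrives.\<close>
  have front_linked: "linked (Front, q) ?y" if "q \<in> Q" for q
    using up_linked _ Q(4) Q(1) Q(4) _ _ that
    by (rule linked_adjacent_face[where X = Left]) (use n i j ij in \<open>auto simp: turns\<close>)
  have back_linked: "linked (Back, q) ?y" if "q \<in> Q" for q
    using up_linked _ Q(2) Q(1) Q(4) _ _ that
    by (rule linked_adjacent_face[where X = Right]) (use n i j ij in \<open>auto simp: turns\<close>)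
  have right_linked: "linked (Right, q) ?y" if "q \<in> Q" for q
    using up_linked _ Q(3) Q(1) Q(4) _ _ that
    by (rule linked_adjacent_face[where X = Front]) (use n i j ij in \<open>auto simp: turns\<close>)
  have left_linked: "linked (Left, q) ?y" if "q \<in> Q" for q
    using up_linked _ Q(1) Q(2) Q(4) _ _ that
    by (rule linked_adjacent_face[where X = Back]) (use n i j ij in \<open>auto simp: turns\<close>)
  have down_linked: "linked (Down, q) ?y" if "q \<in> Q" for q
    using front_linked _ Q(4) Q(1) Q(4) _ _ that
    by (rule linked_adjacent_face[where X = Left]) (use n i j ij in \<open>auto simp: turns\<close>)
  have "linked (f, q) ?y" if "q \<in> Q" for f q
    using up_linked front_linked back_linked right_linked left_linked down_linked that by (cases f) auto
  then have "linked x ?y" "linked y ?y" using assms by (auto simp: orb)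
  then show ?thesis using linked_sym linked_trans by blast
qed

lemma three_cycle_in_orbit_moves:
  assumes "set [x, y, z] \<subseteq> orb" "distinct [x, y, z]"
  shows "cycle_of_list [x, y, z] \<in> orbit_moves"
  using linked_imp_has_cycle[OF all_linked all_linked assms(2)] assms(1) by (simp add: has_cycle_def)

section \<open>The isomorphism with the alternating group\<close>

lemma card_orb: "card orb = 24"
proof -
  have UF: "(UNIV :: face set) = {Up, Down, Front, Back, Right, Left}"
    using face.exhaust by auto
  have "card (UNIV :: face set) = 6" unfolding UF by simp
  moreover have "card Q = 4" using n i j ij by (auto simp: rotations_def card_insert_if)
  ultimately show ?thesis by (simp add: orb card_cartesian_product)
qed

text \<open>Three-cycles generate the alternating group, and a numbering \<open>e\<close> of the
  orbit turns three-cycles of numbers into three-cycles of facelets.\<close>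

lemma map_alt_group_in_orbit_moves:
  assumes e: "bij_betw e {1..24} orb" and p: "p \<in> carrier (alt_group 24)"
  shows "map_permutation {1..24} e p \<in> orbit_moves"
proof -
  let ?M = "map_permutation {1..24::nat} e"
  have inj: "inj_on e {1..24}" and img: "e ` {1..24} = orb" using e by (auto simp: bij_betw_def)
  have id_K: "id \<in> orbit_moves" unfolding orbit_moves_def using moves.id by simp
  have cyc: "?M p \<in> orbit_moves" if p: "p \<in> three_cycles 24" for p
  proof -
    obtain cs where cs: "p = cycle_of_list cs" "cycle cs" "length cs = 3" "set cs \<subseteq> {1..24}"
      using p by blast
    obtain a b c where abc: "cs = [a, b, c]"
      using cs(3) by (auto simp: numeral_3_eq_3 length_Suc_conv)
    have m: "a \<in> {1..24}" "b \<in> {1..24}" "c \<in> {1..24}" using cs(4) abc by auto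
    have "p = transpose a b \<circ> transpose b c" by (simp add: cs(1) abc)
    then have "?M p = ?M (transpose a b) \<circ> ?M (transpose b c)"
      using m inj by (simp only: map_permutation_compose' permutes_swap_id)
    also have "\<dots> = cycle_of_list [e a, e b, e c]"
      using m inj by (simp add: map_permutation_transpose)
    finally have "?M p = cycle_of_list [e a, e b, e c]" .
    moreover have "cycle_of_list [e a, e b, e c] \<in> orbit_moves"
    proof (rule three_cycle_in_orbit_moves)
      show "set [e a, e b, e c] \<subseteq> orb" using m img by auto
      show "distinct [e a, e b, e c]" using cs(2) m inj by (auto simp: abc inj_on_eq_iff)
    qed
    ultimately show ?thesis by metis
  qed
  have "p \<in> generate (alt_group 24) (three_cycles 24)"
    using p alt_group_carrier_as_three_cycles by blast
  \<comment> \<open>The first conjunct is carried through the induction because the composition rule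
    for \<open>map_permutation\<close> is applied to permutations of the index set.\<close>
  then have "p permutes {1..24} \<and> ?M p \<in> orbit_moves"
  proof (induction rule: generate.induct)
    case one
    show ?case unfolding alt_group_one using id_K map_permutation_id'[OF inj] permutes_id by metis
  next
    case (incl h)
    then show ?case using cyc three_cycles_incl alt_group_carrier by blast
  next
    case (inv h)
    then have h: "h \<in> carrier (alt_group 24)" "h permutes {1..24}" "?M h \<in> orbit_moves"
      using cyc three_cycles_incl alt_group_carrier by blast+
    have ih: "inv' h permutes {1..24}" using h(2) by (rule permutes_inv)
    have "?M (inv' h) \<circ> ?M h = id" "?M h \<circ> ?M (inv' h) = id"
      using map_permutation_compose'[OF inj h(2), of "inv' h"]
        map_permutation_compose'[OF inj ih, of h] permutes_inv_o[OF h(2)]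
        map_permutation_id'[OF inj] by metis+
    then have "inv' (?M h) = ?M (inv' h)" by (intro inv_unique_comp)
    then have "?M (inv' h) \<in> orbit_moves" using inv_closed[OF h(3)] by metis
    then show ?case unfolding alt_group_inv_equality[OF h(1)] using ih by blast
  next
    case (eng h1 h2)
    then have "?M (h1 \<circ> h2) = ?M h1 \<circ> ?M h2" by (intro map_permutation_compose' inj) blast
    moreover have "?M h1 \<circ> ?M h2 \<in> orbit_moves" using eng by (intro comp) blast+
    moreover have "h1 \<circ> h2 permutes {1..24}" using eng by (intro permutes_compose) blast+
    ultimately show ?case unfolding alt_group_mult by (simp only: simp_thms)
  qed
  then show ?thesis by blast
qed

text \<open>Moves fix everything outside \<open>facelets n\<close>, so fixing the facelets outside
  the orbit is the same as fixing all points outside it.\<close>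

lemma Z_eq_restrict_orbit_moves: "Z_center_edge n i j = (\<lambda>g. restrict g (facelets n)) ` orbit_moves"
proof -
  have sub: "orb \<subseteq> facelets n" using Q.in_facelets_P by (simp add: orb)
  have "(\<forall>x \<in> facelets n - orb. restrict g (facelets n) x = x) \<longleftrightarrow> (\<forall>x. x \<notin> orb \<longrightarrow> g x = x)"
    if "g \<in> moves n" for g
    using permutes_not_in[OF moves_permutes[OF that]] sub
    by (metis DiffD1 DiffD2 DiffI restrict_apply')
  then show ?thesis
    unfolding Z_center_edge_def carrier_rubik_group_moves orbit_moves_def by blast
qed

text \<open>The map starts at \<open>alt_group 24\<close>, which is known to be a group; the
  isomorphism can then be reversed without first showing that \<open>Z_center_edge n i j\<close> is
  a subgroup.\<close>

lemma alt_group_iso_Z: "alt_group 24 \<cong> (rubik_group n)\<lparr>carrier := Z_center_edge n i j\<rparr>"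
proof -
  obtain e where e: "bij_betw e {1..24::nat} orb"
    using ex_bij_betw_nat_finite_1[OF finite_orb] unfolding card_orb by blast
  have inj: "inj_on e {1..24}" using e by (simp add: bij_betw_def)
  let ?M = "map_permutation {1..24::nat} e" and ?r = "\<lambda>g. restrict g (facelets n)"
  let ?i = "inv_into {1..24} e"
  have F: "g permutes facelets n" if "g \<in> orbit_moves" for g
    using that by (auto simp: orbit_moves_def intro: moves_permutes)
  have carr: "carrier ((rubik_group n)\<lparr>carrier := Z_center_edge n i j\<rparr>) = Z_center_edge n i j"
    by simp
  have MK: "?M p \<in> orbit_moves" if "p \<in> carrier (alt_group 24)" for p
    by (rule map_alt_group_in_orbit_moves[OF e that])
  have "(\<lambda>p. ?r (?M p)) \<in> iso (alt_group 24) ((rubik_group n)\<lparr>carrier := Z_center_edge n i j\<rparr>)"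
  proof (intro isoI homI bij_betwI')
    fix p q assume pq: "p \<in> carrier (alt_group 24)" "q \<in> carrier (alt_group 24)"
    have M: "?M (p \<circ> q) = ?M p \<circ> ?M q"
      using pq by (intro map_permutation_compose' inj) (simp add: alt_group_carrier)
    show "?r (?M (p \<otimes>\<^bsub>alt_group 24\<^esub> q)) =
        ?r (?M p) \<otimes>\<^bsub>(rubik_group n)\<lparr>carrier := Z_center_edge n i j\<rparr>\<^esub> ?r (?M q)"
      unfolding alt_group_mult M using restrict_mult[OF F[OF MK[OF pq(1)]] F[OF MK[OF pq(2)]]]
      by (simp add: mult_rubik_group)
    show "?r (?M p) = ?r (?M q) \<longleftrightarrow> p = q"
    proof
      assume "?r (?M p) = ?r (?M q)"
      then have "?M p = ?M q" 
        by (rule restrict_inj[OF F[OF MK[OF pq(1)]] F[OF MK[OF pq(2)]]])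
      then have M: "?M p (e x) = ?M q (e x)" for x by simp
      show "p = q"
      proof
        fix x
        have perm: "p permutes {1..24}" "q permutes {1..24}"
          using pq by (auto simp: alt_group_carrier)
        show "p x = q x"
        proof (cases "x \<in> {1..24}")
          case True
          then have "e (p x) = e (q x)"
            using M[of x] by (simp only: map_permutation_apply[OF inj])
          moreover have "p x \<in> {1..24}" "q x \<in> {1..24}"
            using True permutes_in_image[OF perm(1)] permutes_in_image[OF perm(2)] by blast+
          ultimately show ?thesis using inj_onD[OF inj] by blast
        next
          case False
          then show ?thesis
            using permutes_not_in[OF perm(1) False] permutes_not_in[OF perm(2) False] by simp
        qed
      qed
    qed simp
  next
    fix p assume p: "p \<in> carrier (alt_group 24)"
    have "?r (?M p) \<in> Z_center_edge n i j" unfolding Z_eq_restrict_orbit_moves by (rule imageI[OF MK[OF p]])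
    then show "?r (?M p) \<in> carrier ((rubik_group n)\<lparr>carrier := Z_center_edge n i j\<rparr>)"
      unfolding carr .
    then show "?r (?M p) \<in> carrier ((rubik_group n)\<lparr>carrier := Z_center_edge n i j\<rparr>)" .
  next
    fix z assume "z \<in> carrier ((rubik_group n)\<lparr>carrier := Z_center_edge n i j\<rparr>)"
    then have "z \<in> ?r ` orbit_moves" unfolding carr unfolding Z_eq_restrict_orbit_moves .
    then obtain g where g: "g \<in> orbit_moves" "z = ?r g" by blast
    \<comment> \<open>The preimage is \<open>g\<close> transported back along the numbering. It is
      even by \<open>orbit_moves_even\<close>: this is where the upper bound enters.\<close>
    define p where "p = map_permutation orb ?i g"
    have i': "bij_betw ?i orb {1..24}" using e by (rule bij_betw_inv_into)
    have "p permutes {1..24}"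
      unfolding p_def using i' orbit_moves_permutes[OF g(1)] by (rule map_permutation_permutes)
    moreover have "evenperm p"
      unfolding p_def
      using evenperm_map_permutation[OF bij_betw_imp_inj_on[OF i'] orbit_moves_permutes[OF g(1)] finite_orb]
        orbit_moves_even[OF g(1)] by simp
    ultimately have "p \<in> carrier (alt_group 24)" by (simp add: alt_group_carrier)
    moreover have "?M p = g"
      unfolding p_def
      by (rule map_permutation_compose_inv[OF i' orbit_moves_permutes[OF g(1)]])
         (use e in \<open>auto simp: bij_betw_def f_inv_into_f\<close>)
    ultimately show "\<exists>p \<in> carrier (alt_group 24). z = ?r (?M p)" using g(2) by blast
  qed
  then show ?thesis unfolding is_iso_def by blast
qed

end

theorem theorem13:
  fixes n i j :: nat
  assumes "n \<ge> 5"
    and "2 \<le> i" and "i \<le> n div 2"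
    and "2 \<le> j" and "j \<le> (n + 1) div 2"
    and "j \<noteq> i"
  shows "(rubik_group n)\<lparr>carrier := Z_center_edge n i j\<rparr> \<cong> alt_group 24"
proof -
  interpret center_edge n i j using assms by unfold_locales
  show ?thesis using group.iso_sym[OF alt_group_is_group alt_group_iso_Z] .
qed

end
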